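(* Let $G=(V,E)$ be a connected graph with $n$ nodes and $m$ edges, and let ${\cal P}=\{S_1,S_2\}$ be a two-way partition of the nodes of $G$. Construct a signed network $G_s=(V,E,W)$ by assigning all the edges within the same set of ${\cal P}$ to be positive and all the edges between the two sets to be negative, and let $\mathbf{w}({\cal P})$ be the weight vector of this signed network. Then $\mathbf{w}({\cal P})$ is a codeword for the graph $G=(V,E)$; that is, for any fundamental cycle matrix $\mathbf{H}$ for $G$, $\mathbf{H}\cdot \mathbf{w}({\cal P})^T=\mathbf{0}_{m-n+1}$ in $\mathrm{GF}(2)$.
   Context: Graphs are finite, simple and undirected. A two-way partition ${\cal P}=\{S_1,S_2\}$ of the nodes consists of two disjoint nonempty sets with $S_1\cup S_2=V$. A signed network $G_s=(V,E,W)$ is a graph $(V,E)$ together with a function $W:E\to\{+,-\}$; an edge with sign $+$ is positive and an edge with sign $-$ is negative. Index the edges of $G$ by $1,2,\ldots,m$. Every (simple) cycle of $G$ is represented by the binary vector $\mathbf{h}=(h_1,\ldots,h_m)\in \mathrm{GF}(2)^m$ with $h_j=1$ if the $j$-th edge is in the cycle and $h_j=0$ otherwise. For a connected graph with $n$ nodes and $m$ edges, the maximum number of cycles that are linearly independent over $\mathrm{GF}(2)$ is $m-n+1$. A cycle basis is a collection of $m-n+1$ cycles whose vectors $\mathbf{h}_i=(h_{i,1},\ldots,h_{i,m})$ are linearly independent over $\mathrm{GF}(2)$, and the $(m-n+1)\times m$ matrix $\mathbf{H}=(h_{i,j})$ formed from any cycle basis is called a fundamental cycle matrix for $G$. The weight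 vector of a signed network is the row vector $\mathbf{w}=(w_1,\ldots,w_m)\in\mathrm{GF}(2)^m$ with $w_j=0$ if the $j$-th edge is positive and $w_j=1$ if it is negative. A vector $\mathbf{w}\in\mathrm{GF}(2)^m$ is a codeword for $G$ if $\mathbf{H}\cdot\mathbf{w}^T=\mathbf{0}_{m-n+1}$ (the zero vector of dimension $m-n+1$), with the matrix product in $\mathrm{GF}(2)$. *)

theory Defs
  imports "HOL-Library.Z2" "Jordan_Normal_Form.VS_Connect"
begin

definition simple_graph :: "'a set \<Rightarrow> 'a set set \<Rightarrow> bool" where
  "simple_graph V E \<longleftrightarrow> finite V \<and> (\<forall>e\<in>E. e \<subseteq> V \<and> card e = 2)"

definition connected_graph :: "'a set \<Rightarrow> 'a set set \<Rightarrow> bool" where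
  "connected_graph V E \<longleftrightarrow>
     (\<forall>u\<in>V. \<forall>v\<in>V. (u, v) \<in> {(x, y). {x, y} \<in> E}\<^sup>*)"

text \<open>A list without repetitions indexes the edges; its first entry has index 0.\<close>

definition edge_indexing :: "'a set set \<Rightarrow> 'a set list \<Rightarrow> bool" where
  "edge_indexing E es \<longleftrightarrow> distinct es \<and> set es = E"

definition two_way_partition :: "'a set \<Rightarrow> 'a set set \<Rightarrow> bool" where
  "two_way_partition V P \<longleftrightarrow>
     (\<exists>S1 S2. P = {S1, S2} \<and> S1 \<noteq> {} \<and> S2 \<noteq> {} \<and> S1 \<inter> S2 = {} \<and> S1 \<union> S2 = V)"

datatype sign = Positive | Negative

text \<open>For a two-way partition \<open>P\<close> of the nodes, an edge contained in no member of \<open>P\<close> is one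
  between the two members. Only the values on edges of the graph matter.\<close>

definition partition_sign :: "'a set set \<Rightarrow> 'a set \<Rightarrow> sign" where
  "partition_sign P e = (if \<exists>S\<in>P. e \<subseteq> S then Positive else Negative)"

definition weight_vector :: "'a set list \<Rightarrow> ('a set \<Rightarrow> sign) \<Rightarrow> bit vec" where
  "weight_vector es W =
     vec (length es) (\<lambda>j. case W (es ! j) of Positive \<Rightarrow> 0 | Negative \<Rightarrow> 1)"

text \<open>A simple cycle is identified with its edge set; it visits at least three nodes,
  each exactly once, and returns to the first.\<close>

definition is_cycle :: "'a set \<Rightarrow> 'a set set \<Rightarrow> 'a set set \<Rightarrow> bool" where
  "is_cycle V E C \<longleftrightarrow>
     (\<exists>vs. length vs \<ge> 3 \<and> distinct vs \<and> set vs \<subseteq> V \<and>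
        C = {{vs ! i, vs ! (Suc i mod length vs)} | i. i < length vs} \<and> C \<subseteq> E)"

definition cycle_vector :: "'a set list \<Rightarrow> 'a set set \<Rightarrow> bit vec" where
  "cycle_vector es C = vec (length es) (\<lambda>j. if es ! j \<in> C then 1 else 0)"

text \<open>The number \<open>m - n + 1\<close>, arranged so that subtraction on the naturals does not truncate:
  a connected graph satisfies \<open>n \<le> m + 1\<close>, with equality for trees.\<close>

definition cyclomatic_number :: "'a set \<Rightarrow> 'a set set \<Rightarrow> nat" where
  "cyclomatic_number V E = card E + 1 - card V"

text \<open>Independence of a family of vectors is distinctness together with
  independence of the set of its members.\<close>

definition cycle_basis :: "'a set \<Rightarrow> 'a set set \<Rightarrow> 'a set list \<Rightarrow> 'a set set list \<Rightarrow> bool" where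
  "cycle_basis V E es Cs \<longleftrightarrow>
     length Cs = cyclomatic_number V E \<and>
     (\<forall>C\<in>set Cs. is_cycle V E C) \<and>
     distinct (map (cycle_vector es) Cs) \<and>
     LinearCombinations.module.lin_indpt class_ring (module_vec TYPE(bit) (length es))
       (set (map (cycle_vector es) Cs))"

definition fundamental_cycle_matrix ::
    "'a set \<Rightarrow> 'a set set \<Rightarrow> 'a set list \<Rightarrow> bit mat \<Rightarrow> bool" where
  "fundamental_cycle_matrix V E es H \<longleftrightarrow>
     (\<exists>Cs. cycle_basis V E es Cs \<and> H = mat_of_rows (length es) (map (cycle_vector es) Cs))"

definition codeword :: "'a set \<Rightarrow> 'a set set \<Rightarrow> 'a set list \<Rightarrow> bit vec \<Rightarrow> bool" where
  "codeword V E es w \<longleftrightarrow>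
     w \<in> carrier_vec (length es) \<and>
     (\<forall>H. fundamental_cycle_matrix V E es H \<longrightarrow> H *\<^sub>v w = 0\<^sub>v (cyclomatic_number V E))"

end

theory Submission
  imports Defs
begin

text \<open>Let \<open>c\<close> be the indicator function of one part, with values in GF(2). The weight of an edge
  \<open>{u, v}\<close> is the coboundary \<open>c u + c v\<close>, so its sum around a cycle counts the value \<open>c v\<close> of
  every node on the cycle twice.\<close>

text \<open>Successor modulo \<open>k\<close> permutes the indices: only the last one wraps around,
  and its term \<open>f 0\<close> is the one split off from the right-hand sum.\<close>

lemma sum_cyclic_shift:
  fixes f :: "nat \<Rightarrow> 'b::comm_monoid_add"
  shows "(\<Sum>i<k. f (Suc i mod k)) = (\<Sum>i<k. f i)"
proof (cases k)
  case (Suc l)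
  have "(\<Sum>i<l. f (Suc i mod Suc l)) = (\<Sum>i<l. f (Suc i))"
    by (rule sum.cong) auto
  then show ?thesis
    unfolding Suc by (subst (2) sum.lessThan_Suc_shift) (simp add: add.commute)
qed simp

text \<open>A cycle is stored as a set of edges; injectivity turns a sum over this set into a sum
  over positions. With two nodes it would fail, since both positions give the same edge.\<close>

lemma inj_on_cycle_edges:
  assumes "distinct vs" and "length vs \<ge> 3"
  shows "inj_on (\<lambda>i. {vs ! i, vs ! (Suc i mod length vs)}) {..<length vs}"
proof (rule inj_onI)
  let ?k = "length vs"
  fix i j
  assume ij: "i \<in> {..<?k}" "j \<in> {..<?k}"
    and eq: "{vs ! i, vs ! (Suc i mod ?k)} = {vs ! j, vs ! (Suc j mod ?k)}"
  have lt: "Suc i mod ?k < ?k" "Suc j mod ?k < ?k"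
    using ij by (auto intro!: mod_less_divisor)
  from eq consider "vs ! i = vs ! j"
    | "vs ! i = vs ! (Suc j mod ?k)" "vs ! (Suc i mod ?k) = vs ! j"
    by (auto simp: doubleton_eq_iff)
  then show "i = j"
  proof cases
    case 1
    then show ?thesis using ij assms(1) by (simp add: nth_eq_iff_index_eq)
  next
    \<comment> \<open>The edge is traversed in opposite directions, so \<open>i\<close> is congruent
      to \<open>i + 2\<close> modulo \<open>?k\<close>, which is impossible for \<open>?k\<close> at
      least 3.\<close>
    case 2
    then have "i = Suc j mod ?k" "Suc i mod ?k = j"
      using ij lt assms(1) by (simp_all add: nth_eq_iff_index_eq)
    then show ?thesis
      using ij assms(2) by (auto simp: mod_Suc split: if_splits)
  qed
qed

lemma sum_coboundary_cycle:
  fixes c :: "'a \<Rightarrow> bit" and g :: "'a set \<Rightarrow> bit"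
  assumes "is_cycle V E C"
    and g: "\<And>u v. {u, v} \<in> E \<Longrightarrow> g {u, v} = c u + c v"
  shows "(\<Sum>e\<in>C. g e) = 0"
proof -
  from assms(1) obtain vs where vs: "length vs \<ge> 3" "distinct vs" "C \<subseteq> E"
    and C: "C = {{vs ! i, vs ! (Suc i mod length vs)} | i. i < length vs}"
    unfolding is_cycle_def by blast
  let ?k = "length vs"
  let ?edge = "\<lambda>i. {vs ! i, vs ! (Suc i mod ?k)}"
  have C': "C = ?edge ` {..<?k}"
    unfolding C by auto
  have "(\<Sum>e\<in>C. g e) = (\<Sum>i<?k. g (?edge i))"
    unfolding C' using inj_on_cycle_edges[OF vs(2,1)] by (simp add: sum.reindex)
  also have "\<dots> = (\<Sum>i<?k. c (vs ! i) + c (vs ! (Suc i mod ?k)))"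
    using vs(3) C' by (intro sum.cong refl g) auto
  also have "\<dots> = (\<Sum>i<?k. c (vs ! i)) + (\<Sum>i<?k. c (vs ! i))"
    by (simp only: sum.distrib sum_cyclic_shift[of "\<lambda>i. c (vs ! i)"])
  also have "\<dots> = 0"
    by simp
  finally show ?thesis .
qed

text \<open>Distinctness of \<open>es\<close> makes indexing a bijection onto the edges, and
  \<open>C \<subseteq> set es\<close> ensures that no edge of the cycle is lost when positions
  replace edges.\<close>

lemma cycle_vector_scalar_prod:
  assumes "distinct es" and "C \<subseteq> set es"
  shows "cycle_vector es C \<bullet> weight_vector es W
    = (\<Sum>e\<in>C. case W e of Positive \<Rightarrow> 0 | Negative \<Rightarrow> 1)"
proof -
  let ?w = "\<lambda>e. case W e of Positive \<Rightarrow> 0 | Negative \<Rightarrow> (1::bit)"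
  have "cycle_vector es C \<bullet> weight_vector es W
    = (\<Sum>j<length es. if es ! j \<in> C then ?w (es ! j) else 0)"
    unfolding scalar_prod_def cycle_vector_def weight_vector_def
    by (rule sum.cong) auto
  also have "\<dots> = (\<Sum>e\<in>set es. if e \<in> C then ?w e else 0)"
    by (rule sum.reindex_bij_betw[OF bij_betw_nth[OF assms(1) refl refl]])
  also have "\<dots> = (\<Sum>e\<in>C. ?w e)"
    using assms(2) by (simp add: sum.inter_restrict[symmetric] Int_absorb1)
  finally show ?thesis .
qed

text \<open>Endpoints in the same part contribute 0 + 0 or 1 + 1, both zero in GF(2); endpoints in
  different parts contribute exactly one 1.\<close>

lemma partition_sign_coboundary:
  assumes "S1 \<inter> S2 = {}" and "u \<in> S1 \<union> S2" and "v \<in> S1 \<union> S2"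
  shows "(case partition_sign {S1, S2} {u, v} of Positive \<Rightarrow> 0 | Negative \<Rightarrow> 1)
    = (of_bool (u \<in> S1) + of_bool (v \<in> S1) :: bit)"
  using assms by (auto simp: partition_sign_def)

theorem lemma3:
  fixes V :: "'a set" and E :: "'a set set" and es :: "'a set list" and P :: "'a set set"
  assumes "simple_graph V E"
    and "connected_graph V E"
    and "edge_indexing E es"
    and "two_way_partition V P"
  shows "codeword V E es (weight_vector es (partition_sign P))"
proof -
  let ?w = "weight_vector es (partition_sign P)"
  from assms(3) have es: "distinct es" "set es = E"
    by (auto simp: edge_indexing_def)
  from assms(4) obtain S1 S2 where P: "P = {S1, S2}" "S1 \<inter> S2 = {}" "S1 \<union> S2 = V"
    by (auto simp: two_way_partition_def)
  have ends: "u \<in> V \<and> v \<in> V" if "{u, v} \<in> E" for u v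
    using assms(1) that by (auto simp: simple_graph_def)
  have row: "cycle_vector es C \<bullet> ?w = 0" if C: "is_cycle V E C" for C
  proof -
    from C have "C \<subseteq> set es"
      by (auto simp: is_cycle_def es(2))
    moreover have "(\<Sum>e\<in>C. case partition_sign P e of Positive \<Rightarrow> 0 | Negative \<Rightarrow> (1::bit)) = 0"
      using C
    proof (rule sum_coboundary_cycle)
      \<comment> \<open>Unification with the goal below chooses the indicator of \<open>S1\<close>
        as the node function \<open>c\<close>.\<close>
      fix u v assume "{u, v} \<in> E"
      then show "(case partition_sign P {u, v} of Positive \<Rightarrow> 0 | Negative \<Rightarrow> 1)
          = (of_bool (u \<in> S1) + of_bool (v \<in> S1) :: bit)"
        unfolding P(1) using ends P(2,3) by (intro partition_sign_coboundary) auto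
    qed
    ultimately show ?thesis
      by (simp add: cycle_vector_scalar_prod[OF es(1)])
  qed
  have "H *\<^sub>v ?w = 0\<^sub>v (cyclomatic_number V E)" if "fundamental_cycle_matrix V E es H" for H
  proof -
    from that obtain Cs where Cs: "length Cs = cyclomatic_number V E"
        "\<And>C. C \<in> set Cs \<Longrightarrow> is_cycle V E C"
      and H: "H = mat_of_rows (length es) (map (cycle_vector es) Cs)"
      by (auto simp: fundamental_cycle_matrix_def cycle_basis_def)
    show ?thesis
    \<comment> \<open>Entry \<open>i\<close> of the product is the scalar product of row
      \<open>i\<close> with \<open>?w\<close>, and that row is the vector of a basis cycle, so
      \<open>row\<close> applies. The dimensions agree because \<open>H\<close> has one row per
      member of \<open>Cs\<close>.\<close>
    proof (rule eq_vecI)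
      fix i assume "i < dim_vec (0\<^sub>v (cyclomatic_number V E) :: bit vec)"
      then have i: "i < length Cs"
        by (simp add: Cs(1))
      then have "row H i = cycle_vector es (Cs ! i)"
        unfolding H by (subst mat_of_rows_row) (auto simp: cycle_vector_def)
      then show "(H *\<^sub>v ?w) $ i = 0\<^sub>v (cyclomatic_number V E) $ i"
        using i Cs row by (simp add: H)
    qed (simp add: H Cs(1))
  qed
  then show ?thesis
    by (simp add: codeword_def weight_vector_def)
qed

end
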